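(* The following identity holds: $$ \begin{aligned} 1&+q^2\frac{t+wq}{1-tq^2}+q^6\frac{w^2+vq+xq^2}{(1-tq^2)(1-wq^3)}+q^{12}\frac{1+q+v^2q^2+xvq^3+x^2q^4+q^5+q^6}{(1-tq^2)(1-wq^3)(1-vq^7)}\\ &+q^{20}\frac{x+xq+q^2+q^3+(1+x^3)q^4+(1+x)q^5+(1+x)q^6+q^7+q^8+q^9+q^{10}}{(1-tq^2)(1-wq^3)(1-xq^8)(1-vq^7)}\\ &+q^{30}\frac{(1+q+q^2+q^3+q^4+q^5+q^6)(1+q^4)}{(1-tq^2)(1-wq^3)(1-xq^8)(1-q^5)(1-vq^7)}\\ &+q^{42}\frac{(1+q+q^2+q^3+q^4+q^5+q^6)(1+q^4)}{(1-tq^2)(1-wq^3)(1-xq^8)(1-q^5)(1-q^6)(1-vq^7)}\\ &+q^{56}\frac{1+q^4}{(1-q)(1-tq^2)(1-wq^3)(1-xq^8)(1-q^5)(1-q^6)(1-vq^7)}\\ &+\sum_{m=8}^\infty\frac{q^{m(m+1)}}{(1-q)(1-tq^2)(1-wq^3)(1-q^4)(1-q^5)(1-q^6)(1-vq^7)(1-xq^8)\prod_{i=9}^{m}(1-q^i)}\\ &=\frac{1}{(1-tq^2)(1-wq^3)(1-vq^7)(1-xq^8)}\prod_{k=2}^\infty\frac{1}{(1-q^{5k+2})(1-q^{5k+3})}. \end{aligned} $$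
   Context: The identity is one of formal power series in $q$ with coefficients in $\mathbb{Z}[t,w,v,x]$, where $t,w,v,x$ are indeterminates. Empty products are $1$. *)

theory Defs
  imports "HOL-Analysis.Infinite_Products" "HOL-Computational_Algebra.Polynomial"
    "HOL-Computational_Algebra.Formal_Power_Series"
begin

text \<open>
  The coefficient ring $\mathbf{Z}[t,w,v,x]$ as $\mathbf{Z}[t][w][v][x]$: the innermost
  polynomial variable is \<open>t\<close>, the outermost one is \<open>x\<close>.
\<close>

type_synonym coeff_ring = "int poly poly poly poly"

definition indet_t :: coeff_ring where "indet_t = [:[:[:[:0, 1:]:]:]:]"
definition indet_w :: coeff_ring where "indet_w = [:[:[:0, 1:]:]:]"
definition indet_v :: coeff_ring where "indet_v = [:[:0, 1:]:]"
definition indet_x :: coeff_ring where "indet_x = [:0, 1:]"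

text \<open>
  The library's division of formal power series needs a coefficient type with an
  \<open>inverse\<close> operation, which polynomial rings do not have. The following quotient is
  meaningful for denominators with constant coefficient \<open>1\<close>; these are units over any
  commutative ring, as the next two lemmas record.
\<close>

definition fps_quot :: "'a::comm_ring_1 fps \<Rightarrow> 'a fps \<Rightarrow> 'a fps" (infixl \<open>\<oslash>\<close> 70)
  where "f \<oslash> g = f * fps_right_inverse g 1"

lemma fps_quot_mult:
  fixes f g :: "'a::comm_ring_1 fps"
  assumes "fps_nth g 0 = 1"
  shows "(f \<oslash> g) * g = f"
  using fps_right_inverse[of g 1] assms
  by (simp add: fps_quot_def mult.assoc mult.commute[of g])

lemma fps_quot_eq_iff:
  fixes f g h :: "'a::comm_ring_1 fps"
  assumes "fps_nth g 0 = 1"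
  shows "f \<oslash> g = h \<longleftrightarrow> f = h * g"
proof
  show "f \<oslash> g = h \<Longrightarrow> f = h * g"
    using fps_quot_mult[OF assms, of f] by simp
  show "f = h * g \<Longrightarrow> f \<oslash> g = h"
    using fps_right_inverse[of g 1] assms by (simp add: fps_quot_def mult.assoc)
qed

end

theory Submission
  imports Defs
begin

text \<open>
  Write $(q)_n = (1-q)\cdots(1-q^n)$, let $D$ be the denominator on the right and
  $K = (1-q^2)(1-q^3)(1-q^7)(1-q^8)$. Multiplied by $D$, the first eight terms on the left lose
  $t, w, v, x$ one after the other and add up to $K \sum_{m<8} q^{m(m+1)}/(q)_m$, while each later
  term becomes $K q^{m(m+1)}/(q)_m$. Since $K$ is also the product of the two factors missing on
  the right, what remains is the second Rogers-Ramanujan identity.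

  That identity is obtained by Bressoud's method: the finite Jacobi triple product gives a Bailey
  pair, two applications of the Bailey lemma produce a finite identity whose right-hand
  side contains the theta coefficients for the base $q^5$, and the finite triple product with base
  $q^5$ sums these modulo $q^{M+1}$.
\<close>

subsection \<open>The Bailey lemma\<close>

text \<open>
  \<open>u k\<close> plays the role of $1/(q)_k$, with value \<open>0\<close> for negative \<open>k\<close>: at \<open>k \<le> 0\<close> the
  recurrence reads \<open>u (k - 1) = 0\<close>, since \<open>nat k = 0\<close>.
\<close>

locale q_factorial_inverse =
  fixes q :: "'a::idom" and u :: "int \<Rightarrow> 'a"
  assumes u_0 [simp]: "u 0 = 1"
    and u_diff_1: "u (k - 1) = u k * (1 - q ^ nat k)"
    and power_neq_1: "n > 0 \<Longrightarrow> q ^ n \<noteq> 1"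
begin

lemma u_neg [simp]:
  assumes "k < 0"
  shows "u k = 0"
proof -
  have "u (- 1 - int n) = 0" for n
  proof (induction n)
    case 0
    show ?case using u_diff_1[of 0] by simp
  next
    case (Suc n)
    have "- 1 - int (Suc n) = (- 1 - int n) - 1" by simp
    then show ?case using u_diff_1[of "- 1 - int n"] Suc by simp
  qed
  from this[of "nat (- 1 - k)"] assms show ?thesis by simp
qed

lemma u_Suc: "u (int n) = u (int n + 1) * (1 - q ^ Suc n)"
  using u_diff_1[of "int n + 1"] by (simp add: nat_add_distrib)

text \<open>Takes the place of division: the inductions below multiply by \<open>1 - q ^ n\<close>
  and cancel it again.\<close>

lemma mult_power_diff_cancel:
  assumes "n > 0" "(1 - q ^ n) * x = (1 - q ^ n) * y"
  shows "x = y"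
  using assms power_neq_1[of n] by auto

text \<open>A limiting case of the q-Chu-Vandermonde sum. Multiplied by
  \<open>1 - q ^ Suc n\<close>, the sum for \<open>Suc n\<close> and \<open>m\<close> splits by a
  q-Pascal rule into two sums that recombine to the sum for \<open>n\<close> and
  \<open>Suc m\<close>; hence \<open>m\<close> is arbitrary in the induction.\<close>

lemma sum_vandermonde:
  "(\<Sum>s\<le>n. q ^ (s * (s + m)) * u (int n - int s) * u (int s) * u (int s + int m))
    = u (int n) * u (int n + int m)"
proof (induction n arbitrary: m)
  case 0
  then show ?case by simp
next
  case (Suc n)
  define f where "f s = q ^ (s * (s + m)) * u (int s + int m)" for s
  \<comment> \<open>From \<open>1 - q^(n+1) = q^s (1 - q^(n+1-s)) + (1 - q^s)\<close>: each bracket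
    lowers the index of one of the two factors \<open>u\<close>.\<close>
  have pascal: "(1 - q ^ Suc n) * (u (int (Suc n) - int s) * u (int s))
      = q ^ s * (u (int n - int s) * u (int s)) + u (int (Suc n) - int s) * u (int s - 1)"
    if "s \<le> Suc n" for s
  proof -
    have a: "u (int n - int s) = u (int (Suc n) - int s) * (1 - q ^ (Suc n - s))"
    proof -
      have "int (Suc n) - int s - 1 = int n - int s" "nat (int (Suc n) - int s) = Suc n - s"
        by simp_all
      then show ?thesis using u_diff_1[of "int (Suc n) - int s"] by (simp only:)
    qed
    have b: "u (int s - 1) = u (int s) * (1 - q ^ s)"
      using u_diff_1[of "int s"] by simp
    have c: "q ^ Suc n = q ^ s * q ^ (Suc n - s)"
      using that by (simp flip: power_add)
    show ?thesis unfolding a b c by (simp add: algebra_simps)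
  qed
  have "(1 - q ^ Suc n) * (\<Sum>s\<le>Suc n. f s * (u (int (Suc n) - int s) * u (int s)))
      = (\<Sum>s\<le>Suc n. f s * (q ^ s * (u (int n - int s) * u (int s))))
        + (\<Sum>s\<le>Suc n. f s * (u (int (Suc n) - int s) * u (int s - 1)))"
    unfolding sum_distrib_left sum.distrib[symmetric]
  proof (rule sum.cong[OF refl])
    fix s assume "s \<in> {..Suc n}"
    then have s: "s \<le> Suc n" by simp
    have "(1 - q ^ Suc n) * (f s * (u (int (Suc n) - int s) * u (int s)))
        = f s * ((1 - q ^ Suc n) * (u (int (Suc n) - int s) * u (int s)))"
      by (simp only: ac_simps)
    then show "(1 - q ^ Suc n) * (f s * (u (int (Suc n) - int s) * u (int s)))
        = f s * (q ^ s * (u (int n - int s) * u (int s)))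
          + f s * (u (int (Suc n) - int s) * u (int s - 1))"
      by (simp only: pascal[OF s] distrib_left)
  qed
  \<comment> \<open>The term \<open>s = Suc n\<close> contains \<open>u (- 1) = 0\<close>; in the
    sum after it the same happens at \<open>s = 0\<close>, which permits the shift of
    \<open>s\<close>.\<close>
  also have "(\<Sum>s\<le>Suc n. f s * (q ^ s * (u (int n - int s) * u (int s))))
      = (\<Sum>s\<le>n. f s * (q ^ s * (u (int n - int s) * u (int s))))"
    by simp
  also have "(\<Sum>s\<le>Suc n. f s * (u (int (Suc n) - int s) * u (int s - 1)))
      = (\<Sum>s\<le>n. f (Suc s) * (u (int n - int s) * u (int s)))"
    by (subst sum.atMost_Suc_shift) (simp add: algebra_simps)
  \<comment> \<open>Over the common factor \<open>u (int s + int (Suc m))\<close> the two summands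
    carry \<open>1 - q ^ Suc (s + m)\<close> and \<open>q ^ Suc (s + m)\<close>, which add up to
    1.\<close>
  also have "(\<Sum>s\<le>n. f s * (q ^ s * (u (int n - int s) * u (int s))))
      + (\<Sum>s\<le>n. f (Suc s) * (u (int n - int s) * u (int s)))
      = (\<Sum>s\<le>n. q ^ (s * (s + Suc m)) * u (int n - int s) * u (int s) * u (int s + int (Suc m)))"
    unfolding sum.distrib[symmetric]
  proof (rule sum.cong[OF refl])
    fix s
    have a: "u (int s + int m) = u (int s + int (Suc m)) * (1 - q ^ Suc (s + m))"
      using u_Suc[of "s + m"] by (simp add: algebra_simps)
    have b: "u (int (Suc s) + int m) = u (int s + int (Suc m))"
      by (simp add: algebra_simps)
    have c: "q ^ (Suc s * (Suc s + m)) = q ^ (s * (s + m)) * q ^ s * q ^ Suc (s + m)"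
      "q ^ (s * (s + Suc m)) = q ^ (s * (s + m)) * q ^ s"
      unfolding power_add[symmetric] by (simp_all add: algebra_simps)
    show "f s * (q ^ s * (u (int n - int s) * u (int s)))
        + f (Suc s) * (u (int n - int s) * u (int s))
        = q ^ (s * (s + Suc m)) * u (int n - int s) * u (int s) * u (int s + int (Suc m))"
      unfolding f_def a b c by (simp add: algebra_simps)
  qed
  also have "\<dots> = u (int n) * u (int n + int (Suc m))"
    by (rule Suc.IH)
  also have "\<dots> = (1 - q ^ Suc n) * (u (int (Suc n)) * u (int (Suc n) + int m))"
  proof -
    have "u (int n) = u (int (Suc n)) * (1 - q ^ Suc n)" using u_Suc[of n] by (simp add: add.commute)
    moreover have "int n + int (Suc m) = int (Suc n) + int m" by simp
    ultimately show ?thesis by (simp only: ac_simps)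
  qed
  finally have "(\<Sum>s\<le>Suc n. f s * (u (int (Suc n) - int s) * u (int s)))
      = u (int (Suc n)) * u (int (Suc n) + int m)"
    by (rule mult_power_diff_cancel[rotated]) simp
  then show ?case by (simp add: f_def mult_ac)
qed

text \<open>The terms with \<open>r < k\<close> vanish, and \<open>r = s + k\<close> turns the
  others into \<open>sum_vandermonde\<close> for \<open>N - k\<close> and \<open>2 * k + 1\<close>.
  For \<open>k > N\<close> both sides are 0.\<close>

lemma bailey_lemma_nonneg:
  "(\<Sum>r\<le>N. q ^ (r * (r + 1)) * u (int N - int r) * (u (int r - int k) * u (int r + int k + 1)))
    = q ^ (k * (k + 1)) * (u (int N - int k) * u (int N + int k + 1))"
proof (cases "k \<le> N")
  case False
  then show ?thesis by simp
next
  case True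
  then obtain n where N: "N = n + k" by (metis le_add_diff_inverse2)
  have "(\<Sum>r\<le>N. q ^ (r * (r + 1)) * u (int N - int r) * (u (int r - int k) * u (int r + int k + 1)))
      = (\<Sum>r\<in>{0+k..n+k}. q ^ (r * (r + 1)) * u (int N - int r) * (u (int r - int k) * u (int r + int k + 1)))"
    unfolding N by (rule sum.mono_neutral_right) auto
  also have "\<dots> = (\<Sum>s\<le>n. q ^ (k * (k + 1)) *
      (q ^ (s * (s + (2 * k + 1))) * u (int n - int s) * u (int s) * u (int s + int (2 * k + 1))))"
    unfolding sum.shift_bounds_cl_nat_ivl atLeast0AtMost
  proof (rule sum.cong[OF refl])
    fix s
    have a: "q ^ ((s + k) * (s + k + 1)) = q ^ (k * (k + 1)) * q ^ (s * (s + (2 * k + 1)))"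
      unfolding power_add[symmetric] by (rule arg_cong[of _ _ "\<lambda>n. q ^ n"]) (simp add: algebra_simps)
    have b: "int N - int (s + k) = int n - int s" "int (s + k) - int k = int s"
      "int (s + k) + int k + 1 = int s + int (2 * k + 1)"
      unfolding N by simp_all
    show "q ^ ((s + k) * (s + k + 1)) * u (int N - int (s + k))
          * (u (int (s + k) - int k) * u (int (s + k) + int k + 1))
        = q ^ (k * (k + 1)) *
          (q ^ (s * (s + (2 * k + 1))) * u (int n - int s) * u (int s) * u (int s + int (2 * k + 1)))"
      unfolding a b by (simp only: ac_simps)
  qed
  also have "\<dots> = q ^ (k * (k + 1)) * (u (int n) * u (int n + int (2 * k + 1)))"
    unfolding sum_distrib_left[symmetric] sum_vandermonde ..
  finally show ?thesis by (simp add: N add_ac)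
qed

text \<open>Replacing \<open>j\<close> by \<open>- 1 - j\<close> changes neither side and carries
  negative indices to nonnegative ones.\<close>

lemma bailey_lemma:
  "(\<Sum>r\<le>N. q ^ (r * (r + 1)) * u (int N - int r) * (u (int r - j) * u (int r + j + 1)))
    = q ^ nat (j * (j + 1)) * (u (int N - j) * u (int N + j + 1))"
proof (cases "j \<ge> 0")
  case True
  then obtain k where k: "j = int k" using nonneg_int_cases by blast
  have "nat (j * (j + 1)) = k * (k + 1)"
    unfolding k by (metis nat_int of_nat_1 of_nat_add of_nat_mult)
  then show ?thesis using bailey_lemma_nonneg[of N k] unfolding k by simp
next
  case False
  then have "0 \<le> - 1 - j" by simp
  then obtain k where "- 1 - j = int k" using nonneg_int_cases by blast
  then have k: "j = - int k - 1" by simp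
  have "nat (j * (j + 1)) = k * (k + 1)"
  proof -
    have "j * (j + 1) = int (k * (k + 1))" unfolding k by (simp add: algebra_simps)
    then show ?thesis by (simp only: nat_int)
  qed
  then show ?thesis using bailey_lemma_nonneg[of N k] unfolding k by (simp add: algebra_simps)
qed

text \<open>One step along the Bailey chain, by interchanging the sums: its effect on the
  coefficients \<open>c j\<close> is multiplication by \<open>q ^ nat (j * (j + 1))\<close>.\<close>

lemma bailey_lemma_sum:
  "(\<Sum>N\<le>M. q ^ (N * (N + 1)) * u (int M - int N) * (\<Sum>j\<in>J. c j * (u (int N - j) * u (int N + j + 1))))
    = (\<Sum>j\<in>J. c j * q ^ nat (j * (j + 1)) * (u (int M - j) * u (int M + j + 1)))"
proof -
  have "(\<Sum>N\<le>M. q ^ (N * (N + 1)) * u (int M - int N) * (\<Sum>j\<in>J. c j * (u (int N - j) * u (int N + j + 1))))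
      = (\<Sum>N\<le>M. \<Sum>j\<in>J. c j * (q ^ (N * (N + 1)) * u (int M - int N) * (u (int N - j) * u (int N + j + 1))))"
    unfolding sum_distrib_left by (intro sum.cong refl) (simp only: ac_simps)
  also have "\<dots> = (\<Sum>j\<in>J. \<Sum>N\<le>M. c j * (q ^ (N * (N + 1)) * u (int M - int N) * (u (int N - j) * u (int N + j + 1))))"
    by (rule sum.swap)
  also have "\<dots> = (\<Sum>j\<in>J. c j * (q ^ nat (j * (j + 1)) * (u (int M - j) * u (int M + j + 1))))"
    unfolding sum_distrib_left[symmetric] bailey_lemma ..
  finally show ?thesis by (simp add: mult.assoc)
qed

end

subsection \<open>The finite Jacobi triple product\<close>

text \<open>
  For $ab = q$ this is $(-1)^j a^j q^{j(j-1)/2}$; the second parameter replaces the powers of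
  $q/a$ that occur for negative \<open>j\<close>.
\<close>

definition theta_coeff :: "'a::comm_ring_1 \<Rightarrow> 'a \<Rightarrow> 'a \<Rightarrow> int \<Rightarrow> 'a"
  where "theta_coeff q a b j =
    (if j \<ge> 0 then \<Prod>i<nat j. - (a * q ^ i) else \<Prod>i<nat (- j). - (b * q ^ i))"

lemma theta_coeff_uminus: "theta_coeff q a b (- j) = theta_coeff q b a j"
  by (cases j "0::int" rule: linorder_cases) (simp_all add: theta_coeff_def)

lemma theta_coeff_0 [simp]: "theta_coeff q a b 0 = 1"
  by (simp add: theta_coeff_def)

lemma theta_coeff_of_nat: "theta_coeff q a b (int n) = (\<Prod>i<n. - (a * q ^ i))"
  by (simp add: theta_coeff_def)

lemma theta_coeff_neg: "theta_coeff q a b (- int n) = (\<Prod>i<n. - (b * q ^ i))"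
  by (simp add: theta_coeff_uminus theta_coeff_of_nat)

text \<open>Neighbouring coefficients have ratio \<open>- a q^j\<close>; the factor
  \<open>q ^ nat (int N - j)\<close> keeps the exponents nonnegative when
  \<open>j < 0\<close>.\<close>

lemma theta_coeff_step:
  assumes "a * b = q" "j \<le> int N"
  shows "q ^ nat (int N - j) * theta_coeff q a b (j + 1) = - (a * q ^ N) * theta_coeff q a b j"
proof (cases "j \<ge> 0")
  case True
  then obtain k where k: "j = int k" using nonneg_int_cases by blast
  have "int k + 1 = int (Suc k)" by simp
  moreover have "q ^ N = q ^ (N - k) * q ^ k"
    using assms(2) unfolding k by (simp flip: power_add)
  ultimately show ?thesis
    using assms(2) unfolding k
    by (simp only: theta_coeff_of_nat) (simp add: nat_diff_distrib' mult_ac)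
next
  case False
  then have "0 \<le> - 1 - j" by simp
  then obtain k where "- 1 - j = int k" using nonneg_int_cases by blast
  then have k: "j = - int (Suc k)" "j + 1 = - int k" by simp_all
  have "nat (int N - j) = N + Suc k" unfolding k by simp
  \<comment> \<open>One factor \<open>q\<close> is spent as \<open>a * b\<close>; its
    \<open>b\<close> joins \<open>q ^ k\<close> to form the last factor of
    \<open>theta_coeff q a b j\<close>.\<close>
  then have p: "q ^ nat (int N - j) = q ^ N * q ^ k * (a * b)"
    by (simp add: power_add assms(1) mult_ac)
  show ?thesis unfolding p k(2) unfolding k(1) theta_coeff_neg by (simp add: mult_ac)
qed

context q_factorial_inverse
begin

text \<open>The sum side of the finite triple product divided by \<open>(q)_(N+M)\<close>, which
  turns the q-binomial coefficients into products of two values of \<open>u\<close>. The two bounds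
  are separate so that an induction can raise one of them.\<close>

definition jacobi_sum :: "'a \<Rightarrow> 'a \<Rightarrow> nat \<Rightarrow> nat \<Rightarrow> 'a"
  where "jacobi_sum a b N M =
    (\<Sum>j=- int M..int N. theta_coeff q a b j * (u (int N - j) * u (int M + j)))"

lemma jacobi_sum_commute: "jacobi_sum a b N M = jacobi_sum b a M N"
  unfolding jacobi_sum_def
  by (rule sum.reindex_bij_witness[of _ uminus uminus])
    (auto simp: theta_coeff_uminus mult_ac)

text \<open>With \<open>1 - q^(N+M+1) = (1 - q^(N+1-j)) + q^(N+1-j) (1 - q^(M+j))\<close> the first
  part gives the sum for \<open>N\<close>; by \<open>theta_coeff_step\<close> the second, shifted by
  one in \<open>j\<close>, gives \<open>- (a * q ^ N)\<close> times the same sum.\<close>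

lemma jacobi_sum_Suc:
  assumes "a * b = q"
  shows "(1 - q ^ Suc (N + M)) * jacobi_sum a b (Suc N) M = (1 - a * q ^ N) * jacobi_sum a b N M"
proof -
  let ?e = "theta_coeff q a b"
  have split: "(1 - q ^ Suc (N + M)) * (?e j * (u (int (Suc N) - j) * u (int M + j)))
      = ?e j * (u (int N - j) * u (int M + j))
        + ?e j * q ^ nat (int (Suc N) - j) * (u (int (Suc N) - j) * u (int M + j - 1))"
    if "j \<in> {- int M..int (Suc N)}" for j
  proof -
    have a: "u (int N - j) = u (int (Suc N) - j) * (1 - q ^ nat (int (Suc N) - j))"
      using u_diff_1[of "int (Suc N) - j"] by (simp add: algebra_simps)
    have b: "u (int M + j - 1) = u (int M + j) * (1 - q ^ nat (int M + j))"
      by (rule u_diff_1)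
    have c: "q ^ Suc (N + M) = q ^ nat (int (Suc N) - j) * q ^ nat (int M + j)"
      using that unfolding power_add[symmetric] by (intro arg_cong[of _ _ "\<lambda>n. q ^ n"]) auto
    show ?thesis unfolding a b c by (simp add: algebra_simps)
  qed
  have "(1 - q ^ Suc (N + M)) * jacobi_sum a b (Suc N) M
      = (\<Sum>j=- int M..int (Suc N). ?e j * (u (int N - j) * u (int M + j)))
        + (\<Sum>j=- int M..int (Suc N).
            ?e j * q ^ nat (int (Suc N) - j) * (u (int (Suc N) - j) * u (int M + j - 1)))"
    unfolding jacobi_sum_def sum_distrib_left sum.distrib[symmetric]
    by (rule sum.cong[OF refl]) (rule split)
  \<comment> \<open>The terms dropped here and in the next step, \<open>j = int (Suc N)\<close> and
    \<open>j = - int M\<close>, contain \<open>u (- 1)\<close>.\<close>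
  also have "(\<Sum>j=- int M..int (Suc N). ?e j * (u (int N - j) * u (int M + j))) = jacobi_sum a b N M"
    unfolding jacobi_sum_def by (rule sum.mono_neutral_right) auto
  also have "(\<Sum>j=- int M..int (Suc N).
        ?e j * q ^ nat (int (Suc N) - j) * (u (int (Suc N) - j) * u (int M + j - 1)))
      = (\<Sum>j=- int M + 1..int N + 1.
        ?e j * q ^ nat (int (Suc N) - j) * (u (int (Suc N) - j) * u (int M + j - 1)))"
    by (rule sum.mono_neutral_right) auto
  also have "\<dots> = (\<Sum>j=- int M..int N. - (a * q ^ N) * (?e j * (u (int N - j) * u (int M + j))))"
  proof (rule sum.reindex_bij_witness[of _ "\<lambda>j. j + 1" "\<lambda>j. j - 1"])
    fix j assume "j \<in> {- int M + 1..int N + 1}"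
    then have "q ^ nat (int N - (j - 1)) * ?e (j - 1 + 1) = - (a * q ^ N) * ?e (j - 1)"
      by (intro theta_coeff_step assms) auto
    moreover have idx: "int N - (j - 1) = int (Suc N) - j" "j - 1 + 1 = j"
      "int M + (j - 1) = int M + j - 1" by simp_all
    ultimately have "- (a * q ^ N) * ?e (j - 1) = ?e j * q ^ nat (int (Suc N) - j)"
      by (simp only: mult.commute)
    then show "- (a * q ^ N) * (?e (j - 1) * (u (int N - (j - 1)) * u (int M + (j - 1))))
        = ?e j * q ^ nat (int (Suc N) - j) * (u (int (Suc N) - j) * u (int M + j - 1))"
      by (simp only: idx mult.assoc[symmetric])
  qed auto
  also have "\<dots> = - (a * q ^ N) * jacobi_sum a b N M"
    unfolding jacobi_sum_def sum_distrib_left ..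
  finally show ?thesis by (simp add: algebra_simps)
qed

text \<open>The induction step for the product formula; \<open>p\<close> is left open so that it
  serves both for \<open>M = 0\<close> and for general \<open>M\<close>.\<close>

lemma jacobi_sum_Suc_eq:
  assumes "a * b = q" "jacobi_sum a b N M = u (int (N + M)) * p"
  shows "jacobi_sum a b (Suc N) M = u (int (Suc N + M)) * ((1 - a * q ^ N) * p)"
proof (rule mult_power_diff_cancel[of "Suc (N + M)"])
  have "(1 - q ^ Suc (N + M)) * jacobi_sum a b (Suc N) M = (1 - a * q ^ N) * (u (int (N + M)) * p)"
    unfolding jacobi_sum_Suc[OF assms(1)] assms(2) ..
  also have "\<dots> = (1 - q ^ Suc (N + M)) * (u (int (Suc N + M)) * ((1 - a * q ^ N) * p))"
  proof -
    have "u (int (N + M)) = u (int (Suc N + M)) * (1 - q ^ Suc (N + M))"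
      using u_Suc[of "N + M"] by (simp add: add_ac)
    then show ?thesis by (simp only: ac_simps)
  qed
  finally show "(1 - q ^ Suc (N + M)) * jacobi_sum a b (Suc N) M
      = (1 - q ^ Suc (N + M)) * (u (int (Suc N + M)) * ((1 - a * q ^ N) * p))" .
qed simp

theorem finite_jacobi_triple_product:
  assumes "a * b = q"
  shows "jacobi_sum a b N M
    = u (int (N + M)) * ((\<Prod>i<N. 1 - a * q ^ i) * (\<Prod>i<M. 1 - b * q ^ i))"
proof -
  \<comment> \<open>Stated for all \<open>a\<close> and \<open>b\<close>, since the case
    \<open>N = 0\<close> below uses it with the two exchanged.\<close>
  have base: "jacobi_sum a b n 0 = u (int n) * (\<Prod>i<n. 1 - a * q ^ i)" if "a * b = q" for a b n
  proof (induction n)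
    case 0
    show ?case by (simp add: jacobi_sum_def)
  next
    case (Suc n)
    then have "jacobi_sum a b n 0 = u (int (n + 0)) * (\<Prod>i<n. 1 - a * q ^ i)"
      by simp
    from jacobi_sum_Suc_eq[OF that this] show ?case by (simp add: mult_ac)
  qed
  show ?thesis
  proof (induction N)
    case 0
    show ?case
      using base[of b a M] assms by (simp add: jacobi_sum_commute[of a] mult.commute)
  next
    case (Suc N)
    show ?case using jacobi_sum_Suc_eq[OF assms Suc] by (simp add: mult_ac)
  qed
qed

text \<open>The unit Bailey pair: for \<open>a = 1\<close> the triple product contains the factor
  \<open>1 - q^0 = 0\<close> unless \<open>N = 0\<close>. Terms outside
  \<open>- N - 1 \<le> j \<le> N\<close> vanish, so one range of \<open>j\<close> serves all
  \<open>N \<le> M\<close>.\<close>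

lemma bailey_pair_sum:
  assumes "N \<le> M"
  shows "(\<Sum>j=- int M - 1..int M. theta_coeff q 1 q j * (u (int N - j) * u (int N + j + 1)))
    = (if N = 0 then 1 else 0)"
proof -
  have "(\<Sum>j=- int M - 1..int M. theta_coeff q 1 q j * (u (int N - j) * u (int N + j + 1)))
      = jacobi_sum 1 q N (Suc N)"
    unfolding jacobi_sum_def using assms
    by (intro sum.mono_neutral_cong_right) (auto simp: algebra_simps)
  also have "\<dots> = u (int (N + Suc N)) * ((\<Prod>i<N. 1 - 1 * q ^ i) * (\<Prod>i<Suc N. 1 - q * q ^ i))"
    by (rule finite_jacobi_triple_product) simp
  also have "\<dots> = (if N = 0 then 1 else 0)"
  proof (cases "N = 0")
    case True
    then show ?thesis using u_Suc[of 0] by simp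
  next
    case False
    then have "(\<Prod>i<N. 1 - 1 * q ^ i) = 0"
      by (intro prod_zero bexI[of _ 0]) auto
    then show ?thesis using False by simp
  qed
  finally show ?thesis .
qed

text \<open>Two Bailey steps from the unit pair; each contributes one factor
  \<open>q ^ nat (j * (j + 1))\<close>.\<close>

theorem finite_rogers_ramanujan:
  "(\<Sum>N\<le>M. q ^ (N * (N + 1)) * u (int M - int N) * u (int N))
    = (\<Sum>j=- int M - 1..int M. theta_coeff q 1 q j * q ^ nat (j * (j + 1)) * q ^ nat (j * (j + 1))
        * (u (int M - j) * u (int M + j + 1)))"
proof -
  let ?J = "{- int M - 1..int M}"
  \<comment> \<open>The first Bailey step: only \<open>r = 0\<close> survives on the other
    side.\<close>
  have *: "(\<Sum>j\<in>?J. theta_coeff q 1 q j * q ^ nat (j * (j + 1)) * (u (int N - j) * u (int N + j + 1))) = u (int N)"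
    if "N \<le> M" for N
  proof -
    have "(\<Sum>j\<in>?J. theta_coeff q 1 q j * q ^ nat (j * (j + 1)) * (u (int N - j) * u (int N + j + 1)))
        = (\<Sum>r\<le>N. q ^ (r * (r + 1)) * u (int N - int r) * (if r = 0 then 1 else 0))"
      unfolding bailey_lemma_sum[symmetric]
      using that by (intro sum.cong refl) (simp add: bailey_pair_sum)
    also have "\<dots> = (\<Sum>r\<le>N. if r = 0 then u (int N) else 0)"
      by (intro sum.cong refl) auto
    finally show ?thesis by simp
  qed
  show ?thesis
    by (subst bailey_lemma_sum[symmetric]) (intro sum.cong refl, simp only: * atMost_iff)
qed

end

subsection \<open>Congruence of power series and the second Rogers-Ramanujan identity\<close>

lemma fps_X_power_dvd_iff:
  fixes f :: "'a::comm_ring_1 fps"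
  shows "fps_X ^ n dvd f \<longleftrightarrow> (\<forall>i<n. fps_nth f i = 0)"
proof
  assume "fps_X ^ n dvd f"
  then show "\<forall>i<n. fps_nth f i = 0" by (auto simp: fps_X_power_mult_nth elim!: dvdE)
next
  assume *: "\<forall>i<n. fps_nth f i = 0"
  have "f = fps_X ^ n * fps_shift n f"
    using * by (intro fps_ext) (auto simp: fps_X_power_mult_nth)
  then show "fps_X ^ n dvd f" by (metis dvd_triv_left)
qed

definition fps_cong :: "nat \<Rightarrow> 'a::comm_ring_1 fps \<Rightarrow> 'a fps \<Rightarrow> bool"
  where "fps_cong n f g \<longleftrightarrow> fps_X ^ n dvd f - g"

lemma fps_cong_refl [simp]: "fps_cong n f f"
  by (simp add: fps_cong_def)

lemma fps_cong_sym: "fps_cong n f g \<Longrightarrow> fps_cong n g f"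
  unfolding fps_cong_def by (subst dvd_minus_iff[symmetric]) simp

lemma fps_cong_trans [trans]: "fps_cong n f g \<Longrightarrow> fps_cong n g h \<Longrightarrow> fps_cong n f h"
  unfolding fps_cong_def using dvd_add[of "fps_X ^ n" "f - g" "g - h"] by simp

lemma fps_cong_mono: "fps_cong n f g \<Longrightarrow> m \<le> n \<Longrightarrow> fps_cong m f g"
  unfolding fps_cong_def using le_imp_power_dvd dvd_trans by blast

lemma fps_cong_add: "fps_cong n f g \<Longrightarrow> fps_cong n f' g' \<Longrightarrow> fps_cong n (f + f') (g + g')"
  unfolding fps_cong_def using dvd_add[of "fps_X ^ n" "f - g" "f' - g'"] by (simp add: algebra_simps)

lemma fps_cong_sum: "(\<And>i. i \<in> A \<Longrightarrow> fps_cong n (f i) (g i)) \<Longrightarrow> fps_cong n (sum f A) (sum g A)"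
  unfolding fps_cong_def sum_subtractf[symmetric] by (rule dvd_sum)

text \<open>A factor divisible by \<open>fps_X ^ m\<close> raises the modulus by \<open>m\<close>;
  this makes up for weak congruences in the outer terms of a sum.\<close>

lemma fps_cong_dvd_mult:
  assumes "fps_X ^ m dvd h" "fps_cong n f g" "k \<le> m + n"
  shows "fps_cong k (h * f) (h * g)"
proof -
  have "fps_X ^ (m + n) dvd h * (f - g)"
    unfolding power_add using assms(1,2) by (intro mult_dvd_mono) (simp_all add: fps_cong_def)
  then show ?thesis
    using assms(3) unfolding fps_cong_def
    by (metis dvd_trans le_imp_power_dvd right_diff_distrib)
qed

lemma fps_cong_mult:
  assumes "fps_cong n f g" "fps_cong n f' g'"
  shows "fps_cong n (f * f') (g * g')"
proof -
  have "fps_cong n (f * f') (f * g')"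
    using assms(2) by (intro fps_cong_dvd_mult[of 0]) auto
  also have "fps_cong n (g' * f) (g' * g)"
    using assms(1) by (intro fps_cong_dvd_mult[of 0]) auto
  then have "fps_cong n (f * g') (g * g')" by (simp add: mult.commute)
  finally show ?thesis .
qed

lemma fps_cong_mult_left: "fps_cong n f g \<Longrightarrow> fps_cong n (h * f) (h * g)"
  by (intro fps_cong_mult fps_cong_refl)

lemma fps_cong_imp_eq:
  assumes "\<And>n. fps_cong n f g"
  shows "f = g"
proof (rule fps_ext)
  fix i
  show "fps_nth f i = fps_nth g i"
    using assms[of "Suc i"] by (simp add: fps_cong_def fps_X_power_dvd_iff del: power_Suc)
qed

text \<open>Completeness in the \<open>fps_X\<close>-adic topology, with an explicit rate that later
  allows a return to partial sums and products.\<close>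

lemma fps_cong_limit:
  fixes f :: "nat \<Rightarrow> 'a::comm_ring_1 fps"
  assumes "\<And>n. fps_cong n (f (Suc n)) (f n)"
  obtains L where "f \<longlonglongrightarrow> L" "\<And>n. fps_cong n L (f n)"
proof -
  have *: "fps_cong n (f m) (f n)" if "m \<ge> n" for m n
    using that
  proof (induction m rule: dec_induct)
    case (step m)
    have "fps_cong n (f (Suc m)) (f m)" using assms[of m] step by (auto intro: fps_cong_mono)
    also note step.IH
    finally show ?case .
  qed simp
  have nth: "fps_nth (f m) i = fps_nth (f n) i" if "m \<ge> n" "i < n" for m n i
    using *[OF that(1)] that(2) by (simp add: fps_cong_def fps_X_power_dvd_iff)
  \<comment> \<open>Coefficient \<open>i\<close> no longer changes from index \<open>Suc i\<close>
    on.\<close>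
  define L where "L = Abs_fps (\<lambda>i. fps_nth (f (Suc i)) i)"
  have L: "fps_nth (f n) i = fps_nth L i" if "i < n" for i n
    using nth[of "Suc i" n i] that by (simp add: L_def)
  show thesis
  proof
    show "fps_cong n L (f n)" for n
      by (simp add: fps_cong_def fps_X_power_dvd_iff L)
    show "f \<longlonglongrightarrow> L"
    proof (rule tendsto_fpsI)
      fix i
      show "\<forall>\<^sub>F n in sequentially. fps_nth (f n) i = fps_nth L i"
        using eventually_gt_at_top[of i] by eventually_elim (rule L)
    qed
  qed
qed

section \<open>Reciprocals of power series and of q-factorials\<close>

lemma fps_quot_eq_mult: "f \<oslash> g = f * (1 \<oslash> g)"
  by (simp add: fps_quot_def)

lemma fps_quot_cancel:
  assumes "fps_nth g 0 = 1"
  shows "g * (1 \<oslash> g) = 1"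
  using fps_quot_mult[OF assms, of 1] by (simp add: mult.commute)

lemma fps_prod_nth_0: "fps_nth (\<Prod>i\<in>A. f i) 0 = (\<Prod>i\<in>A. fps_nth (f i :: 'a::comm_ring_1 fps) 0)"
  by (induction A rule: infinite_finite_induct) simp_all

lemma fps_quot_prod:
  assumes "\<And>i. i \<in> A \<Longrightarrow> fps_nth (g i) 0 = 1"
  shows "(\<Prod>i\<in>A. 1 \<oslash> g i) = 1 \<oslash> (\<Prod>i\<in>A. g i)"
proof -
  have "fps_nth (\<Prod>i\<in>A. g i) 0 = 1" using assms by (simp add: fps_prod_nth_0)
  moreover have "(\<Prod>i\<in>A. 1 \<oslash> g i) * (\<Prod>i\<in>A. g i) = 1"
    unfolding prod.distrib[symmetric] using assms by (simp add: fps_quot_mult)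
  ultimately show ?thesis using fps_quot_eq_iff by metis
qed

definition qfact :: "'a::comm_ring_1 \<Rightarrow> nat \<Rightarrow> 'a"
  where "qfact q n = (\<Prod>i<n. 1 - q ^ Suc i)"

text \<open>Extended by 0 to negative indices, as the recurrence of
  \<open>q_factorial_inverse\<close> forces.\<close>

definition qfact_inv :: "'a::comm_ring_1 fps \<Rightarrow> int \<Rightarrow> 'a fps"
  where "qfact_inv q k = (if k < 0 then 0 else 1 \<oslash> qfact q (nat k))"

lemma qfact_nth_0: "fps_nth q 0 = 0 \<Longrightarrow> fps_nth (qfact q n) 0 = 1"
  by (simp add: qfact_def fps_prod_nth_0)

lemma qfact_mult_inv: "fps_nth q 0 = 0 \<Longrightarrow> qfact q n * qfact_inv q (int n) = 1"
  by (simp add: qfact_inv_def fps_quot_cancel qfact_nth_0)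

lemma q_factorial_inverse_qfact_inv:
  fixes q :: "'a::idom fps"
  assumes "fps_nth q 0 = 0"
  shows "q_factorial_inverse q (qfact_inv q)"
proof
  show "qfact_inv q 0 = 1"
    using fps_quot_cancel[of 1] by (simp add: qfact_inv_def qfact_def)
  show "q ^ n \<noteq> 1" if "n > 0" for n
  proof
    assume "q ^ n = 1"
    then have "fps_nth (q ^ n) 0 = 1" by simp
    then show False using that assms by (simp add: fps_power_zeroth zero_power)
  qed
  show "qfact_inv q (k - 1) = qfact_inv q k * (1 - q ^ nat k)" for k
  proof (cases k "0::int" rule: linorder_cases)
    case greater
    then obtain n where k: "k = int (Suc n)" by (metis not0_implies_Suc of_nat_0_less_iff less_numeral_extra(3) zero_less_imp_eq_int)
    have "qfact_inv q (int (Suc n)) * (1 - q ^ Suc n) * qfact q n = 1"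
      using qfact_mult_inv[OF assms, of "Suc n"] by (simp add: qfact_def mult_ac)
    then have "1 \<oslash> qfact q n = qfact_inv q (int (Suc n)) * (1 - q ^ Suc n)"
      using fps_quot_eq_iff[OF qfact_nth_0[OF assms]] by metis
    moreover have "qfact_inv q (int (Suc n) - 1) = 1 \<oslash> qfact q n" by (simp add: qfact_inv_def)
    ultimately show ?thesis unfolding k by (simp only: nat_int)
  qed (simp_all add: qfact_inv_def)
qed

text \<open>Passing from \<open>l\<close> to \<open>Suc l\<close> changes the inverse by a multiple
  of \<open>fps_X ^ (d * Suc l)\<close>.\<close>

lemma fps_cong_qfact_inv:
  fixes d :: nat
  assumes "d > 0" "k \<le> l"
  shows "fps_cong (Suc k) (qfact_inv (fps_X ^ d :: 'a::idom fps) (int k)) (qfact_inv (fps_X ^ d) (int l))"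
  using assms(2)
proof (induction l rule: dec_induct)
  case (step l)
  interpret q_factorial_inverse "fps_X ^ d :: 'a fps" "qfact_inv (fps_X ^ d)"
    using assms(1) by (intro q_factorial_inverse_qfact_inv) simp
  note step.IH
  also have "fps_cong (Suc k) (qfact_inv (fps_X ^ d) (int l)) (qfact_inv (fps_X ^ d) (int (Suc l)) :: 'a fps)"
  proof -
    have "qfact_inv (fps_X ^ d) (int l) - qfact_inv (fps_X ^ d) (int (Suc l))
        = - (qfact_inv (fps_X ^ d) (int (Suc l)) * fps_X ^ (d * Suc l) :: 'a fps)"
      unfolding u_Suc[of l] power_mult by (simp add: algebra_simps)
    moreover have "Suc k \<le> d * Suc l"
      using assms(1) step.hyps by (metis Suc_le_mono le_trans mult_le_mono1 nat_mult_1 less_eq_Suc_le One_nat_def order_less_imp_le)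
    ultimately show ?thesis
      unfolding fps_cong_def by (metis dvd_minus_iff dvd_mult le_imp_power_dvd)
  qed
  finally show ?case .
qed simp

text \<open>With \<open>m = max j (- j - 1)\<close> both indices of \<open>u\<close> are at least
  \<open>M - m\<close>, so their product agrees with \<open>u (int M) * u (int M)\<close> modulo
  \<open>fps_X ^ Suc (M - m)\<close>; the coefficient \<open>c j\<close> supplies the missing
  \<open>fps_X ^ m\<close>.\<close>

lemma fps_cong_theta_sum:
  fixes c :: "int \<Rightarrow> 'a::idom fps" and d M :: nat
  assumes "d > 0"
    and "\<And>j. j \<in> {- int M - 1..int M} \<Longrightarrow> fps_X ^ nat (max j (- j - 1)) dvd c j"
  defines "u \<equiv> qfact_inv (fps_X ^ d)"
  shows "fps_cong (Suc M) (\<Sum>j=- int M - 1..int M. c j * (u (int M - j) * u (int M + j + 1)))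
    (u (int M) * u (int M) * (\<Sum>j=- int M - 1..int M. c j))"
proof -
  have "fps_cong (Suc M) (c j * (u (int M - j) * u (int M + j + 1))) (c j * (u (int M) * u (int M)))"
    if j: "j \<in> {- int M - 1..int M}" for j
  proof -
    define m where "m = nat (max j (- j - 1))"
    have m: "m \<le> M" using j by (auto simp: m_def)
    \<comment> \<open>As \<open>k\<close> may lie on either side of \<open>M\<close>, both are
      compared with \<open>M - m\<close>.\<close>
    have near: "fps_cong (Suc (M - m)) (u k) (u (int M))" if "k \<ge> int (M - m)" for k
    proof -
      have "fps_cong (Suc (M - m)) (u (int (M - m))) (u (int (nat k)))"
        unfolding u_def using that assms(1) by (intro fps_cong_qfact_inv) auto
      moreover have "fps_cong (Suc (M - m)) (u (int (M - m))) (u (int M))"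
        unfolding u_def using assms(1) by (intro fps_cong_qfact_inv) auto
      moreover have "int (nat k) = k" using that by simp
      ultimately show ?thesis by (metis fps_cong_sym fps_cong_trans)
    qed
    have "fps_cong (Suc (M - m)) (u (int M - j) * u (int M + j + 1)) (u (int M) * u (int M))"
      using j by (intro fps_cong_mult near) (auto simp: m_def)
    then show ?thesis
      using m assms(2)[OF j] by (intro fps_cong_dvd_mult[of m]) (auto simp: m_def)
  qed
  then have "fps_cong (Suc M) (\<Sum>j=- int M - 1..int M. c j * (u (int M - j) * u (int M + j + 1)))
      (\<Sum>j=- int M - 1..int M. c j * (u (int M) * u (int M)))"
    by (rule fps_cong_sum)
  then show ?thesis by (simp add: sum_distrib_right[symmetric] mult.commute)
qed

text \<open>The exponents agree: \<open>j(j-1)/2 + 2j(j+1) = 4j + 5j(j-1)/2\<close>. The right-hand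
  side is the triple product coefficient for base \<open>q ^ 5\<close>, as
  \<open>q ^ 4 * q = q ^ 5\<close>.\<close>

lemma theta_coeff_rogers_ramanujan:
  fixes q :: "'a::comm_ring_1"
  shows "theta_coeff q 1 q j * q ^ nat (j * (j + 1)) * q ^ nat (j * (j + 1)) = theta_coeff (q ^ 5) (q ^ 4) q j"
proof (cases "j \<ge> 0")
  case True
  then obtain k where k: "j = int k" using nonneg_int_cases by blast
  have e: "nat (j * (j + 1)) = k * (k + 1)"
    unfolding k by (metis nat_int of_nat_1 of_nat_add of_nat_mult)
  have "(\<Prod>i<k. - (1 * q ^ i)) * q ^ (k * (k + 1)) * q ^ (k * (k + 1)) = (\<Prod>i<k. - (q ^ 4 * (q ^ 5) ^ i))"
  proof (induction k)
    case (Suc k)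
    have "q ^ (Suc k * (Suc k + 1)) = q ^ (k * (k + 1)) * q ^ Suc k * q ^ Suc k"
      unfolding power_add[symmetric] by (rule arg_cong[of _ _ "\<lambda>n. q ^ n"]) (simp add: algebra_simps)
    moreover have "q ^ 4 * (q ^ 5) ^ k = q ^ k * (q ^ Suc k * q ^ Suc k) * (q ^ Suc k * q ^ Suc k)"
      unfolding power_add[symmetric] power_mult[symmetric]
      by (rule arg_cong[of _ _ "\<lambda>n. q ^ n"]) simp
    ultimately show ?case using Suc by (simp add: mult_ac)
  qed simp
  then show ?thesis unfolding e unfolding k theta_coeff_of_nat .
next
  case False
  then have "0 \<le> - 1 - j" by simp
  then obtain k where "- 1 - j = int k" using nonneg_int_cases by blast
  then have k: "j = - int (Suc k)" by simp
  have "j * (j + 1) = int (k * (k + 1))" unfolding k by (simp add: algebra_simps)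
  then have e: "nat (j * (j + 1)) = k * (k + 1)" by (simp only: nat_int)
  \<comment> \<open>For \<open>j = - k - 1\<close> there are \<open>Suc k\<close> factors but the
    exponent is still \<open>k * (k + 1)\<close>; at \<open>k = 0\<close> both sides are
    \<open>- q\<close>.\<close>
  have "(\<Prod>i<Suc k. - (q * q ^ i)) * q ^ (k * (k + 1)) * q ^ (k * (k + 1)) = (\<Prod>i<Suc k. - (q * (q ^ 5) ^ i))"
  proof (induction k)
    case (Suc k)
    have "q ^ (Suc k * (Suc k + 1)) = q ^ (k * (k + 1)) * q ^ Suc k * q ^ Suc k"
      unfolding power_add[symmetric] by (rule arg_cong[of _ _ "\<lambda>n. q ^ n"]) (simp add: algebra_simps)
    moreover have "(q ^ 5) ^ Suc k = q ^ Suc k * (q ^ Suc k * q ^ Suc k) * (q ^ Suc k * q ^ Suc k)"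
      unfolding power_add[symmetric] power_mult[symmetric]
      by (rule arg_cong[of _ _ "\<lambda>n. q ^ n"]) simp
    moreover have "(\<Prod>i<Suc (Suc k). - (q * q ^ i)) = (\<Prod>i<Suc k. - (q * q ^ i)) * - (q * q ^ Suc k)"
      "(\<Prod>i<Suc (Suc k). - (q * (q ^ 5) ^ i)) = (\<Prod>i<Suc k. - (q * (q ^ 5) ^ i)) * - (q * (q ^ 5) ^ Suc k)"
      by simp_all
    ultimately show ?case using Suc by (simp only: mult_ac mult_minus_left mult_minus_right)
  qed simp
  then show ?thesis unfolding e unfolding k theta_coeff_neg .
qed

text \<open>Each factor of the coefficient is divisible by \<open>fps_X\<close>; this crude bound is
  what \<open>fps_cong_theta_sum\<close> asks for.\<close>

lemma theta_coeff_dvd: "fps_X ^ nat (max j (- j - 1)) dvd theta_coeff (fps_X ^ 5) (fps_X ^ 4) (fps_X :: 'a::comm_ring_1 fps) j"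
proof -
  have *: "fps_X ^ n dvd (\<Prod>i<n. - (fps_X ^ Suc m * (fps_X ^ 5) ^ i) :: 'a fps)" for n m
  proof -
    have "(\<Prod>i<n. fps_X) dvd (\<Prod>i<n. - (fps_X ^ Suc m * (fps_X ^ 5) ^ i) :: 'a fps)"
      by (intro prod_dvd_prod) simp
    then show ?thesis by simp
  qed
  show ?thesis
  proof (cases "j \<ge> 0")
    case True
    then show ?thesis using *[of "nat j" 3] by (simp add: theta_coeff_def)
  next
    case False
    then have "fps_X ^ nat (max j (- j - 1)) dvd (fps_X ^ nat (- j) :: 'a fps)"
      by (intro le_imp_power_dvd) auto
    also have "\<dots> dvd theta_coeff (fps_X ^ 5) (fps_X ^ 4) fps_X j"
      using False *[of "nat (- j)" 0] by (simp add: theta_coeff_def)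
    finally show ?thesis .
  qed
qed

text \<open>The factors \<open>1 - q^i\<close> with \<open>1 \<le> i \<le> 5M\<close> sorted by
  \<open>i\<close> modulo 5: residues 0, 4, 1, then 2 and 3 together.\<close>

lemma qfact_5_mult:
  "qfact q (5 * M) = qfact (q ^ 5) M * (\<Prod>i<M. 1 - q ^ 4 * (q ^ 5) ^ i) * (\<Prod>i<M. 1 - q * (q ^ 5) ^ i)
    * (\<Prod>k<M. (1 - q ^ (5 * k + 2)) * (1 - q ^ (5 * k + 3)))"
proof (induction M)
  case (Suc M)
  have "5 * Suc M = Suc (Suc (Suc (Suc (Suc (5 * M)))))" by simp
  then have "qfact q (5 * Suc M) = qfact q (5 * M) * (1 - q ^ (5 * M + 1)) * (1 - q ^ (5 * M + 2))
      * (1 - q ^ (5 * M + 3)) * (1 - q ^ (5 * M + 4)) * (1 - q ^ (5 * M + 5))"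
    by (simp only: qfact_def prod.lessThan_Suc) (simp add: numeral_eq_Suc)
  moreover have "q ^ 4 * (q ^ 5) ^ M = q ^ (5 * M + 4)" "q * (q ^ 5) ^ M = q ^ (5 * M + 1)"
    "(q ^ 5) ^ Suc M = q ^ (5 * M + 5)"
    by (simp_all add: power_add mult_ac flip: power_mult)
  ultimately show ?case
    using Suc by (simp only: qfact_def prod.lessThan_Suc) (simp only: mult_ac)
qed (simp add: qfact_def)

text \<open>Modulo \<open>fps_X ^ Suc M\<close>, the finite identity gives
  \<open>S = u (int M) * \<theta>\<close> and the triple product evaluates \<open>\<theta>\<close>
  as the factors of residues 0, 1, 4 modulo 5. Dividing by the q-factorial leaves the reciprocal of
  residues 2 and 3.\<close>

theorem rogers_ramanujan_cong:
  fixes M :: nat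
  shows "fps_cong (Suc M) (\<Sum>m\<le>M. fps_X ^ (m * (m + 1)) * qfact_inv (fps_X :: 'a::idom fps) (int m))
    (\<Prod>k<M. 1 \<oslash> ((1 - fps_X ^ (5 * k + 2)) * (1 - fps_X ^ (5 * k + 3))))"
proof -
  let ?X = "fps_X :: 'a fps"
  define u where "u = qfact_inv ?X"
  define v where "v = qfact_inv (?X ^ 5)"
  define S where "S = (\<Sum>m\<le>M. ?X ^ (m * (m + 1)) * u (int m))"
  define \<theta> where "\<theta> = (\<Sum>j=- int M - 1..int M. theta_coeff (?X ^ 5) (?X ^ 4) ?X j)"
  define A where "A = (\<Prod>i<M. 1 - ?X ^ 4 * (?X ^ 5) ^ i)"
  define B where "B = (\<Prod>i<M. 1 - ?X * (?X ^ 5) ^ i)"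
  define C where "C = (\<Prod>k<M. (1 - ?X ^ (5 * k + 2)) * (1 - ?X ^ (5 * k + 3)))"
  interpret U: q_factorial_inverse ?X u
    unfolding u_def by (rule q_factorial_inverse_qfact_inv) simp
  interpret V: q_factorial_inverse "?X ^ 5" v
    unfolding v_def by (rule q_factorial_inverse_qfact_inv) simp
  have u1: "qfact ?X n * u (int n) = 1" for n
    unfolding u_def by (rule qfact_mult_inv) simp
  have v1: "qfact (?X ^ 5) n * v (int n) = 1" for n
    unfolding v_def by (rule qfact_mult_inv) simp
  have u_cong: "fps_cong (Suc k) (u (int k)) (u (int l))" if "k \<le> l" for k l
    using fps_cong_qfact_inv[of 1 k l] that by (simp add: u_def)
  have v_cong: "fps_cong (Suc k) (v (int k)) (v (int l))" if "k \<le> l" for k l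
    using fps_cong_qfact_inv[of 5 k l] that by (simp add: v_def)

  \<comment> \<open>Replacing \<open>u (int M - int m)\<close> by \<open>u (int M)\<close> costs
    \<open>m\<close> in the modulus, which \<open>?X ^ (m * (m + 1))\<close> repays.\<close>
  have "fps_cong (Suc M) (u (int M) * S) (\<Sum>m\<le>M. ?X ^ (m * (m + 1)) * u (int M - int m) * u (int m))"
    unfolding S_def sum_distrib_left
  proof (rule fps_cong_sum)
    fix m assume "m \<in> {..M}"
    then have "fps_cong (Suc (M - m)) (u (int M - int m)) (u (int M))"
      using u_cong[of "M - m" M] by (simp add: of_nat_diff)
    then have "fps_cong (Suc (M - m)) (u (int M) * u (int m)) (u (int M - int m) * u (int m))"
      by (intro fps_cong_mult fps_cong_refl) (rule fps_cong_sym)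
    then have "fps_cong (Suc M) (?X ^ (m * (m + 1)) * (u (int M) * u (int m)))
        (?X ^ (m * (m + 1)) * (u (int M - int m) * u (int m)))"
      by (rule fps_cong_dvd_mult[OF le_imp_power_dvd[of m], rotated]) auto
    then show "fps_cong (Suc M) (u (int M) * (?X ^ (m * (m + 1)) * u (int m)))
        (?X ^ (m * (m + 1)) * u (int M - int m) * u (int m))"
      by (simp only: mult_ac)
  qed
  also have "\<dots> = (\<Sum>j=- int M - 1..int M. theta_coeff (?X ^ 5) (?X ^ 4) ?X j
      * (u (int M - j) * u (int M + j + 1)))"
    unfolding U.finite_rogers_ramanujan theta_coeff_rogers_ramanujan ..
  also have "fps_cong (Suc M) \<dots> (u (int M) * u (int M) * \<theta>)"
    using fps_cong_theta_sum[OF _ theta_coeff_dvd, of 1 M]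
    by (simp add: u_def \<theta>_def)
  finally have "fps_cong (Suc M) (qfact ?X M * (u (int M) * S)) (qfact ?X M * (u (int M) * u (int M) * \<theta>))"
    by (rule fps_cong_mult_left)
  then have 1: "fps_cong (Suc M) S (u (int M) * \<theta>)"
    by (simp only: mult.assoc[symmetric] u1 mult_1_left)

  \<comment> \<open>The bounds \<open>M\<close> and \<open>Suc M\<close> reproduce the range of
    \<open>j\<close> and the kernel of the Bailey lemma, now in base \<open>?X ^ 5\<close>.\<close>
  have "V.jacobi_sum (?X ^ 4) ?X M (Suc M)
      = (\<Sum>j=- int M - 1..int M. theta_coeff (?X ^ 5) (?X ^ 4) ?X j * (v (int M - j) * v (int M + j + 1)))"
    unfolding V.jacobi_sum_def by (intro sum.cong) (auto simp: algebra_simps)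
  also have "fps_cong (Suc M) \<dots> (v (int M) * v (int M) * \<theta>)"
    using fps_cong_theta_sum[OF _ theta_coeff_dvd, of 5 M]
    by (simp add: v_def \<theta>_def)
  finally have "fps_cong (Suc M) (v (int M) * v (int M) * \<theta>) (V.jacobi_sum (?X ^ 4) ?X M (Suc M))"
    by (rule fps_cong_sym)
  also have "V.jacobi_sum (?X ^ 4) ?X M (Suc M) = v (int (M + Suc M)) * (A * (B * (1 - ?X ^ (5 * M + 1))))"
    by (subst V.finite_jacobi_triple_product)
      (simp_all add: A_def B_def power_mult[symmetric] flip: power_Suc2)
  \<comment> \<open>The unpaired factor, from the second product having \<open>Suc M\<close>
    factors, is 1 to this order.\<close>
  also have "fps_cong (Suc M) \<dots> (v (int M) * (A * (B * 1)))"
  proof (intro fps_cong_mult fps_cong_refl)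
    show "fps_cong (Suc M) (v (int (M + Suc M))) (v (int M))"
      by (rule fps_cong_sym[OF v_cong]) simp
    have "?X ^ Suc M dvd ?X ^ (5 * M + 1)"
      by (rule le_imp_power_dvd) simp
    then show "fps_cong (Suc M) (1 - ?X ^ (5 * M + 1)) 1"
      by (simp add: fps_cong_def)
  qed
  finally have "fps_cong (Suc M) (qfact (?X ^ 5) M * (qfact (?X ^ 5) M * (v (int M) * v (int M) * \<theta>)))
      (qfact (?X ^ 5) M * (qfact (?X ^ 5) M * (v (int M) * (A * (B * 1)))))"
    by (intro fps_cong_mult_left)
  moreover have "qfact (?X ^ 5) M * (qfact (?X ^ 5) M * (v (int M) * v (int M) * \<theta>))
      = (qfact (?X ^ 5) M * v (int M)) * (qfact (?X ^ 5) M * v (int M)) * \<theta>"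
    "qfact (?X ^ 5) M * (qfact (?X ^ 5) M * (v (int M) * (A * (B * 1))))
      = (qfact (?X ^ 5) M * v (int M)) * (qfact (?X ^ 5) M * A * B)"
    by (simp_all only: mult_ac mult_1_right)
  ultimately have 2: "fps_cong (Suc M) \<theta> (qfact (?X ^ 5) M * A * B)"
    by (simp only: v1 mult_1_left)

  note 1
  \<comment> \<open>The index \<open>5 * M\<close> in place of \<open>M\<close> makes the
    q-factorial the one that \<open>qfact_5_mult\<close> factors.\<close>
  also have "fps_cong (Suc M) (u (int M) * \<theta>) (u (int (5 * M)) * (qfact (?X ^ 5) M * A * B))"
    by (intro fps_cong_mult u_cong 2) simp
  also have "\<dots> = (u (int (5 * M)) * (qfact (?X ^ 5) M * A * B * C)) * (1 \<oslash> C)"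
  proof -
    have "fps_nth C 0 = 1" by (simp add: C_def fps_prod_nth_0)
    then have "C * (1 \<oslash> C) = 1" by (rule fps_quot_cancel)
    then show ?thesis by (simp only: mult.assoc mult_1_right)
  qed
  also have "\<dots> = 1 \<oslash> C"
    using u1[of "5 * M"] unfolding qfact_5_mult A_def[symmetric] B_def[symmetric] C_def[symmetric]
    by (simp add: mult.commute)
  also have "\<dots> = (\<Prod>k<M. 1 \<oslash> ((1 - ?X ^ (5 * k + 2)) * (1 - ?X ^ (5 * k + 3))))"
    unfolding C_def by (rule fps_quot_prod[symmetric]) simp
  finally show ?thesis unfolding S_def u_def .
qed

subsection \<open>The identity with four parameters\<close>

lemma fps_quot_mult_eq:
  assumes "fps_nth g 0 = 1" "E = g * r"
  shows "(f \<oslash> g) * E = f * r"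
  using fps_quot_mult[OF assms(1), of f] by (simp add: assms(2) mult.assoc[symmetric])

text \<open>\<open>K\<close> is \<open>D\<close> with all four parameters set to 1, and
  \<open>P\<close> holds the other factors of \<open>(q)_8\<close>. Thus
  \<open>K * P = qfact q 8\<close>, while \<open>D * P\<close> is a common denominator of the terms
  of \<open>T\<close>.\<close>

context
  fixes q t w v x :: "'a::idom fps" and T D P K :: "'a fps"
  assumes q_0: "fps_nth q 0 = 0"
  defines "D \<equiv> (1 - t * q^2) * (1 - w * q^3) * (1 - v * q^7) * (1 - x * q^8)"
    and "P \<equiv> (1 - q) * (1 - q^4) * (1 - q^5) * (1 - q^6)"
    and "K \<equiv> (1 - q^2) * (1 - q^3) * (1 - q^7) * (1 - q^8)"
    and "T \<equiv> 1 + q^2 * ((t + w * q) \<oslash> (1 - t * q^2))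
              + q^6 * ((w^2 + v * q + x * q^2) \<oslash> ((1 - t * q^2) * (1 - w * q^3)))
              + q^12 * ((1 + q + v^2 * q^2 + x * v * q^3 + x^2 * q^4 + q^5 + q^6)
                  \<oslash> ((1 - t * q^2) * (1 - w * q^3) * (1 - v * q^7)))
              + q^20 * ((x + x * q + q^2 + q^3 + (1 + x^3) * q^4 + (1 + x) * q^5 + (1 + x) * q^6
                    + q^7 + q^8 + q^9 + q^10)
                  \<oslash> ((1 - t * q^2) * (1 - w * q^3) * (1 - x * q^8) * (1 - v * q^7)))
              + q^30 * (((1 + q + q^2 + q^3 + q^4 + q^5 + q^6) * (1 + q^4))
                  \<oslash> ((1 - t * q^2) * (1 - w * q^3) * (1 - x * q^8) * (1 - q^5) * (1 - v * q^7)))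
              + q^42 * (((1 + q + q^2 + q^3 + q^4 + q^5 + q^6) * (1 + q^4))
                  \<oslash> ((1 - t * q^2) * (1 - w * q^3) * (1 - x * q^8) * (1 - q^5) * (1 - q^6)
                      * (1 - v * q^7)))
              + q^56 * ((1 + q^4)
                  \<oslash> ((1 - q) * (1 - t * q^2) * (1 - w * q^3) * (1 - x * q^8) * (1 - q^5)
                      * (1 - q^6) * (1 - v * q^7)))"
begin

section \<open>Clearing denominators in the partial sums\<close>

private lemma one_minus_nth_0: "n > 0 \<Longrightarrow> fps_nth (1 - y * q ^ n) 0 = 1"
    "n > 0 \<Longrightarrow> fps_nth (1 - q ^ n) 0 = 1" "fps_nth (1 - q) 0 = 1"
  by (simp_all add: fps_power_zeroth q_0 zero_power)

private lemma P_nonzero: "P \<noteq> 0"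
proof -
  have "fps_nth P 0 = 1"
    unfolding P_def by (simp add: one_minus_nth_0 del: fps_sub_nth)
  then show ?thesis by auto
qed

private lemma K_mult_P: "K * P = qfact q 8"
  by (simp add: K_def P_def qfact_def lessThan_Suc numeral_eq_Suc mult_ac)

text \<open>The first five denominators divide \<open>D\<close>, so these terms keep the factor
  \<open>P\<close>; the last three contain all of \<open>D\<close>, which cancels together with part
  of \<open>P\<close>.\<close>

private lemma first_terms_polynomial:
  "T * (D * P)
    = (1 + q^12 + q^13 + q^17 + q^18 + q^22 + q^23 + q^24 + q^25 + q^26 + q^27 + q^28 + q^29 + q^30) * P
      + q^30 * ((1 + q + q^2 + q^3 + q^4 + q^5 + q^6) * (1 + q^4) * ((1 - q) * (1 - q^4) * (1 - q^6)))
      + q^42 * ((1 + q + q^2 + q^3 + q^4 + q^5 + q^6) * (1 + q^4) * ((1 - q) * (1 - q^4)))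
      + q^56 * ((1 + q^4) * (1 - q^4))"
proof -
  note one_minus_nth_0 [simp] fps_sub_nth [simp del]
  have 1: "((t + w * q) \<oslash> (1 - t * q^2)) * (D * P)
      = (t + w * q) * ((1 - w * q^3) * (1 - v * q^7) * (1 - x * q^8) * P)"
    by (rule fps_quot_mult_eq) (simp_all add: D_def mult_ac)
  have 2: "((w^2 + v * q + x * q^2) \<oslash> ((1 - t * q^2) * (1 - w * q^3))) * (D * P)
      = (w^2 + v * q + x * q^2) * ((1 - v * q^7) * (1 - x * q^8) * P)"
    by (rule fps_quot_mult_eq) (simp_all add: D_def mult_ac)
  have 3: "((1 + q + v^2 * q^2 + x * v * q^3 + x^2 * q^4 + q^5 + q^6)
        \<oslash> ((1 - t * q^2) * (1 - w * q^3) * (1 - v * q^7))) * (D * P)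
      = (1 + q + v^2 * q^2 + x * v * q^3 + x^2 * q^4 + q^5 + q^6) * ((1 - x * q^8) * P)"
    by (rule fps_quot_mult_eq) (simp_all add: D_def mult_ac)
  have 4: "((x + x * q + q^2 + q^3 + (1 + x^3) * q^4 + (1 + x) * q^5 + (1 + x) * q^6
          + q^7 + q^8 + q^9 + q^10)
        \<oslash> ((1 - t * q^2) * (1 - w * q^3) * (1 - x * q^8) * (1 - v * q^7))) * (D * P)
      = (x + x * q + q^2 + q^3 + (1 + x^3) * q^4 + (1 + x) * q^5 + (1 + x) * q^6
          + q^7 + q^8 + q^9 + q^10) * P"
    by (rule fps_quot_mult_eq) (simp_all add: D_def mult_ac)
  have 5: "(((1 + q + q^2 + q^3 + q^4 + q^5 + q^6) * (1 + q^4))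
        \<oslash> ((1 - t * q^2) * (1 - w * q^3) * (1 - x * q^8) * (1 - q^5) * (1 - v * q^7))) * (D * P)
      = (1 + q + q^2 + q^3 + q^4 + q^5 + q^6) * (1 + q^4) * ((1 - q) * (1 - q^4) * (1 - q^6))"
    by (rule fps_quot_mult_eq) (simp_all add: D_def P_def mult_ac)
  have 6: "(((1 + q + q^2 + q^3 + q^4 + q^5 + q^6) * (1 + q^4))
        \<oslash> ((1 - t * q^2) * (1 - w * q^3) * (1 - x * q^8) * (1 - q^5) * (1 - q^6)
            * (1 - v * q^7))) * (D * P)
      = (1 + q + q^2 + q^3 + q^4 + q^5 + q^6) * (1 + q^4) * ((1 - q) * (1 - q^4))"
    by (rule fps_quot_mult_eq) (simp_all add: D_def P_def mult_ac)
  have 7: "((1 + q^4)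
        \<oslash> ((1 - q) * (1 - t * q^2) * (1 - w * q^3) * (1 - x * q^8) * (1 - q^5)
            * (1 - q^6) * (1 - v * q^7))) * (D * P)
      = (1 + q^4) * (1 - q^4)"
    by (rule fps_quot_mult_eq) (simp_all add: D_def P_def mult_ac)
  \<comment> \<open>Here the parameters disappear: times \<open>D\<close>, the first five terms add
    up to a polynomial in \<open>q\<close> alone.\<close>
  have poly: "D
      + q^2 * ((t + w * q) * ((1 - w * q^3) * (1 - v * q^7) * (1 - x * q^8)))
      + q^6 * ((w^2 + v * q + x * q^2) * ((1 - v * q^7) * (1 - x * q^8)))
      + q^12 * ((1 + q + v^2 * q^2 + x * v * q^3 + x^2 * q^4 + q^5 + q^6) * (1 - x * q^8))
      + q^20 * (x + x * q + q^2 + q^3 + (1 + x^3) * q^4 + (1 + x) * q^5 + (1 + x) * q^6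
                    + q^7 + q^8 + q^9 + q^10)
    = 1 + q^12 + q^13 + q^17 + q^18 + q^22 + q^23 + q^24 + q^25 + q^26 + q^27 + q^28 + q^29 + q^30"
    unfolding D_def by algebra
  show ?thesis
    unfolding poly[symmetric] T_def
    by (simp only: distrib_right[of _ _ "D * P"] mult.assoc[of _ _ "D * P"] 1 2 3 4 5 6 7 mult_1_left)
      (simp only: distrib_right[of _ _ P] mult.assoc)
qed

private lemma qfact_mult_qfact_inv:
  assumes "m \<le> n"
  shows "qfact_inv q (int m) * qfact q n = (\<Prod>i=m..<n. 1 - q ^ Suc i)"
proof -
  have "qfact q n = qfact q m * (\<Prod>i=m..<n. 1 - q ^ Suc i)"
    unfolding qfact_def lessThan_atLeast0 using assms by (simp add: prod.atLeastLessThan_concat)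
  then show ?thesis
    using qfact_mult_inv[OF q_0, of m] by (simp add: mult.assoc[symmetric] mult.commute[of "qfact_inv q (int m)"])
qed

text \<open>After multiplication by \<open>P\<close> both sides are polynomials in \<open>q\<close>,
  since \<open>K * P\<close> is \<open>qfact q 8\<close>; \<open>P\<close> is then
  cancelled.\<close>

private lemma first_terms_eq: "T * D = K * (\<Sum>m<8. q ^ (m * (m + 1)) * qfact_inv q (int m))"
proof -
  have "K * (\<Sum>m<8. q ^ (m * (m + 1)) * qfact_inv q (int m)) * P
      = (\<Sum>m<8. q ^ (m * (m + 1)) * (qfact_inv q (int m) * qfact q 8))"
    unfolding K_mult_P[symmetric] sum_distrib_left sum_distrib_right
    by (simp only: mult_ac)
  also have "\<dots> = (\<Sum>m<8. q ^ (m * (m + 1)) * (\<Prod>i=m..<8. 1 - q ^ Suc i))"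
    by (intro sum.cong refl) (simp add: qfact_mult_qfact_inv)
  also have "\<dots> = (1 - q) * (1 - q^2) * (1 - q^3) * (1 - q^4) * (1 - q^5) * (1 - q^6) * (1 - q^7) * (1 - q^8)
      + q^2 * ((1 - q^2) * (1 - q^3) * (1 - q^4) * (1 - q^5) * (1 - q^6) * (1 - q^7) * (1 - q^8))
      + q^6 * ((1 - q^3) * (1 - q^4) * (1 - q^5) * (1 - q^6) * (1 - q^7) * (1 - q^8))
      + q^12 * ((1 - q^4) * (1 - q^5) * (1 - q^6) * (1 - q^7) * (1 - q^8))
      + q^20 * ((1 - q^5) * (1 - q^6) * (1 - q^7) * (1 - q^8))
      + q^30 * ((1 - q^6) * (1 - q^7) * (1 - q^8))
      + q^42 * ((1 - q^7) * (1 - q^8))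
      + q^56 * (1 - q^8)"
  proof -
    have a: "{..<8::nat} = {0, 1, 2, 3, 4, 5, 6, 7}" by auto
    have b: "{Suc 0..<8::nat} = {1, 2, 3, 4, 5, 6, 7}" "{0..<8::nat} = {0, 1, 2, 3, 4, 5, 6, 7}"
      "{2..<8::nat} = {2, 3, 4, 5, 6, 7}" "{3..<8::nat} = {3, 4, 5, 6, 7}"
      "{4..<8::nat} = {4, 5, 6, 7}" "{5..<8::nat} = {5, 6, 7}" "{6..<8::nat} = {6, 7}"
      "{7..<8::nat} = {7}" by auto
    show ?thesis unfolding a by (simp add: b mult.assoc del: power_Suc flip: numeral_2_eq_2)
  qed
  also have "\<dots> = T * (D * P)"
    unfolding first_terms_polynomial unfolding P_def by algebra
  finally have "T * D * P = K * (\<Sum>m<8. q ^ (m * (m + 1)) * qfact_inv q (int m)) * P"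
    by (simp only: mult.assoc)
  then show ?thesis using P_nonzero by simp
qed

text \<open>Both \<open>E * K\<close> and \<open>D * qfact q m\<close> consist of \<open>D\<close>,
  \<open>P\<close>, \<open>K\<close> and the factors from 9 to \<open>m\<close>.\<close>

private lemma later_term_eq:
  assumes "m \<ge> 8"
  defines "E \<equiv> (1 - q) * (1 - t * q^2) * (1 - w * q^3) * (1 - q^4) * (1 - q^5) * (1 - q^6)
                     * (1 - v * q^7) * (1 - x * q^8) * (\<Prod>i=9..m. 1 - q ^ i)"
  shows "(q ^ k \<oslash> E) * D = K * (q ^ k * qfact_inv q (int m))"
proof -
  have E_0: "fps_nth E 0 = 1"
    unfolding E_def
    by (simp add: one_minus_nth_0 fps_prod_nth_0 del: fps_sub_nth)
  have "qfact q m = K * P * (\<Prod>i=9..m. 1 - q ^ i)"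
  proof -
    have "qfact q m = qfact q 8 * (\<Prod>i=8..<m. 1 - q ^ Suc i)"
      unfolding qfact_def lessThan_atLeast0 using assms by (simp add: prod.atLeastLessThan_concat)
    also have "(\<Prod>i=8..<m. 1 - q ^ Suc i) = (\<Prod>i=9..m. 1 - q ^ i)"
      using assms by (intro prod.reindex_bij_witness[of _ "\<lambda>i. i - 1" Suc]) auto
    finally show ?thesis by (simp add: K_mult_P)
  qed
  then have EK: "D * qfact q m = E * K"
    unfolding D_def P_def E_def by (simp only: mult_ac)
  have "(q ^ k \<oslash> E) * D = (q ^ k \<oslash> E) * (D * qfact q m) * qfact_inv q (int m)"
    using qfact_mult_inv[OF q_0, of m] by (simp add: mult.assoc)
  also have "\<dots> = K * (q ^ k * qfact_inv q (int m))"
    unfolding fps_quot_mult_eq[OF E_0 EK] by (simp only: mult_ac)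
  finally show ?thesis .
qed

lemma rogers_ramanujan_parameter_sum:
  "(T + (\<Sum>n<M. q ^ ((n + 8) * ((n + 8) + 1)) \<oslash>
          ((1 - q) * (1 - t * q^2) * (1 - w * q^3) * (1 - q^4) * (1 - q^5) * (1 - q^6)
                     * (1 - v * q^7) * (1 - x * q^8) * (\<Prod>i=9..n + 8. 1 - q ^ i)))) * D
    = K * (\<Sum>m<M + 8. q ^ (m * (m + 1)) * qfact_inv q (int m))"
proof (induction M)
  case 0
  then show ?case by (simp add: first_terms_eq)
next
  case (Suc M)
  have "Suc M + 8 = Suc (M + 8)" by simp
  moreover have "(T + (s + f)) * D = (T + s) * D + f * D" for s f
    by (simp only: add.assoc[symmetric] distrib_right)
  ultimately show ?case
    unfolding sum.lessThan_Suc
    by (simp only: Suc.IH later_term_eq[OF le_add2] sum.lessThan_Suc distrib_left[of K])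
qed

end

section \<open>Passage to the infinite sum and product\<close>

lemma fps_cong_quot_1:
  assumes "fps_nth g 0 = 1" "fps_cong n g 1"
  shows "fps_cong n (1 \<oslash> g) 1"
proof -
  have "fps_cong n ((1 \<oslash> g) * 1) ((1 \<oslash> g) * g)"
    by (intro fps_cong_mult_left fps_cong_sym[OF assms(2)])
  then show ?thesis using fps_quot_mult[OF assms(1), of 1] by simp
qed

text \<open>The sum and product converge \<open>fps_X\<close>-adically to \<open>\<sigma>\<close>
  and \<open>\<pi>\<close>. Modulo each \<open>fps_X ^ n\<close> these are replaced by partial sums
  and products, which \<open>rogers_ramanujan_parameter_sum\<close> and
  \<open>rogers_ramanujan_cong\<close> compare.\<close>

theorem rogers_ramanujan_parameters:
  fixes t w v x :: "'a::idom fps"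
  defines "q \<equiv> fps_X"
  defines "F \<equiv> (\<lambda>m::nat. q ^ (m * (m + 1)) \<oslash>
                   ((1 - q) * (1 - t * q^2) * (1 - w * q^3) * (1 - q^4) * (1 - q^5) * (1 - q^6)
                     * (1 - v * q^7) * (1 - x * q^8) * (\<Prod>i=9..m. 1 - q ^ i)))"
    and "G \<equiv> (\<lambda>k::nat. 1 \<oslash> ((1 - q ^ (5 * k + 2)) * (1 - q ^ (5 * k + 3))))"
  shows "summable (\<lambda>n. F (n + 8))" and "convergent_prod (\<lambda>n. G (n + 2))"
    and "1 + q^2 * ((t + w * q) \<oslash> (1 - t * q^2))
              + q^6 * ((w^2 + v * q + x * q^2) \<oslash> ((1 - t * q^2) * (1 - w * q^3)))
              + q^12 * ((1 + q + v^2 * q^2 + x * v * q^3 + x^2 * q^4 + q^5 + q^6)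
                  \<oslash> ((1 - t * q^2) * (1 - w * q^3) * (1 - v * q^7)))
              + q^20 * ((x + x * q + q^2 + q^3 + (1 + x^3) * q^4 + (1 + x) * q^5 + (1 + x) * q^6
                    + q^7 + q^8 + q^9 + q^10)
                  \<oslash> ((1 - t * q^2) * (1 - w * q^3) * (1 - x * q^8) * (1 - v * q^7)))
              + q^30 * (((1 + q + q^2 + q^3 + q^4 + q^5 + q^6) * (1 + q^4))
                  \<oslash> ((1 - t * q^2) * (1 - w * q^3) * (1 - x * q^8) * (1 - q^5) * (1 - v * q^7)))
              + q^42 * (((1 + q + q^2 + q^3 + q^4 + q^5 + q^6) * (1 + q^4))
                  \<oslash> ((1 - t * q^2) * (1 - w * q^3) * (1 - x * q^8) * (1 - q^5) * (1 - q^6)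
                      * (1 - v * q^7)))
              + q^56 * ((1 + q^4)
                  \<oslash> ((1 - q) * (1 - t * q^2) * (1 - w * q^3) * (1 - x * q^8) * (1 - q^5)
                      * (1 - q^6) * (1 - v * q^7)))
              + (\<Sum>n. F (n + 8))
            = (1 \<oslash> ((1 - t * q^2) * (1 - w * q^3) * (1 - v * q^7) * (1 - x * q^8)))
                * prodinf (\<lambda>n. G (n + 2))" (is "?T + _ = (1 \<oslash> ?D) * _")
proof -
  have q_0: "fps_nth q 0 = 0" by (simp add: q_def)
  define K where "K = (1 - q^2) * (1 - q^3) * (1 - q^7) * (1 - q^8)"
  have F_dvd: "fps_cong n (F (n + 8)) 0" for n
  proof -
    have "fps_X ^ n dvd q ^ ((n + 8) * (n + 8 + 1))"
      unfolding q_def by (rule le_imp_power_dvd) (simp add: algebra_simps)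
    then show ?thesis
      unfolding F_def fps_quot_def fps_cong_def diff_0_right by (rule dvd_mult2)
  qed
  obtain \<sigma> where \<sigma>: "(\<lambda>n. \<Sum>i<n. F (i + 8)) \<longlonglongrightarrow> \<sigma>" "\<And>n. fps_cong n \<sigma> (\<Sum>i<n. F (i + 8))"
  proof (rule fps_cong_limit[of "\<lambda>n. \<Sum>i<n. F (i + 8)"])
    fix n
    show "fps_cong n (\<Sum>i<Suc n. F (i + 8)) (\<Sum>i<n. F (i + 8))"
      using fps_cong_add[OF fps_cong_refl F_dvd[of n], of "\<Sum>i<n. F (i + 8)"] by simp
  qed (rule that)
  have sums: "(\<lambda>n. F (n + 8)) sums \<sigma>"
    using \<sigma>(1) by (simp add: sums_def)
  then show "summable (\<lambda>n. F (n + 8))" by (rule sums_summable)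

  have G_0: "fps_nth ((1 - q ^ (5 * k + 2)) * (1 - q ^ (5 * k + 3))) 0 = 1" for k
    by (simp add: q_def)
  have G_cong: "fps_cong n (G (n + 2)) 1" for n
    unfolding G_def
  proof (rule fps_cong_quot_1[OF G_0])
    have "fps_cong n (1 - q ^ i) 1" if "i \<ge> n" for i
      using le_imp_power_dvd[OF that] by (simp add: fps_cong_def q_def)
    then have "fps_cong n ((1 - q ^ (5 * (n + 2) + 2)) * (1 - q ^ (5 * (n + 2) + 3))) (1 * 1)"
      by (intro fps_cong_mult) simp_all
    then show "fps_cong n ((1 - q ^ (5 * (n + 2) + 2)) * (1 - q ^ (5 * (n + 2) + 3))) 1"
      by (simp only: mult_1_left)
  qed
  obtain \<pi> where \<pi>: "(\<lambda>n. \<Prod>i<n. G (i + 2)) \<longlonglongrightarrow> \<pi>" "\<And>n. fps_cong n \<pi> (\<Prod>i<n. G (i + 2))"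
  proof (rule fps_cong_limit[of "\<lambda>n. \<Prod>i<n. G (i + 2)"])
    fix n
    show "fps_cong n (\<Prod>i<Suc n. G (i + 2)) (\<Prod>i<n. G (i + 2))"
      using fps_cong_mult_left[OF G_cong[of n], of "\<Prod>i<n. G (i + 2)"] by simp
  qed (rule that)
  \<comment> \<open>Convergence of an infinite product demands a nonzero limit; the constant
    coefficient is that of \<open>G 2\<close>.\<close>
  have "\<pi> \<noteq> 0"
  proof
    assume "\<pi> = 0"
    then have "fps_cong 1 0 (G 2)" using \<pi>(2)[of 1] by (simp add: numeral_2_eq_2)
    then have "fps_nth (G 2) 0 = 0" by (auto simp: fps_cong_def elim!: dvdE)
    moreover have "fps_nth (G 2) 0 = 1" by (simp add: G_def fps_quot_def)
    ultimately show False by simp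
  qed
  then have "raw_has_prod (\<lambda>n. G (n + 2)) 0 \<pi>"
    using \<pi>(1) by (simp add: raw_has_prod_def LIMSEQ_lessThan_iff_atMost)
  then have prod: "(\<lambda>n. G (n + 2)) has_prod \<pi>" "convergent_prod (\<lambda>n. G (n + 2))"
    by (auto simp: has_prod_def convergent_prod_def)
  show "convergent_prod (\<lambda>n. G (n + 2))" by (rule prod(2))

  have "(?T + \<sigma>) * ?D = \<pi>"
  proof (rule fps_cong_imp_eq)
    fix n
    have "fps_cong n ((?T + \<sigma>) * ?D) ((?T + (\<Sum>i<n. F (i + 8))) * ?D)"
      by (intro fps_cong_mult fps_cong_add fps_cong_refl \<sigma>(2))
    also have "\<dots> = K * (\<Sum>m<n + 8. q ^ (m * (m + 1)) * qfact_inv q (int m))"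
      unfolding F_def K_def by (rule rogers_ramanujan_parameter_sum[OF q_0])
    also have "fps_cong n \<dots> (K * (\<Prod>k<n + 7. G k))"
    proof (rule fps_cong_mult_left)
      \<comment> \<open>The bound \<open>m < n + 8\<close> means \<open>M = n + 7\<close>, so the
        congruence holds modulo \<open>fps_X ^ (n + 8)\<close>.\<close>
      have "fps_cong (Suc (n + 7)) (\<Sum>m\<le>n + 7. q ^ (m * (m + 1)) * qfact_inv q (int m)) (\<Prod>k<n + 7. G k)"
        unfolding G_def q_def by (rule rogers_ramanujan_cong)
      moreover have "{..n + 7} = {..<n + 8}" by auto
      ultimately show "fps_cong n (\<Sum>m<n + 8. q ^ (m * (m + 1)) * qfact_inv q (int m)) (\<Prod>k<n + 7. G k)"
        by (auto intro: fps_cong_mono)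
    qed
    also have "K * (\<Prod>k<n + 7. G k) = (\<Prod>k<n + 5. G (k + 2))"
    proof -
      have "n + 7 = Suc (Suc (n + 5))" by simp
      then have "(\<Prod>k<n + 7. G k) = G 0 * G 1 * (\<Prod>k<n + 5. G (k + 2))"
        by (simp only: prod.lessThan_Suc_shift) (simp add: mult.assoc)
      \<comment> \<open>\<open>K\<close> is the product of the denominators of \<open>G 0\<close>
        and \<open>G 1\<close>, with exponents 2, 3 and 7, 8; hence the product starts at
        \<open>k = 2\<close>.\<close>
      moreover have "K * (G 0 * G 1) = 1"
      proof -
        have "K * (G 0 * G 1) = (((1 - q ^ 2) * (1 - q ^ 3)) * G 0) * (((1 - q ^ 7) * (1 - q ^ 8)) * G 1)"
          by (simp only: K_def mult_ac)
        also have "\<dots> = 1"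
        proof -
          have "5 * 0 + 2 = (2::nat)" "5 * 0 + 3 = (3::nat)" "5 * 1 + 2 = (7::nat)" "5 * 1 + 3 = (8::nat)"
            by simp_all
          then show ?thesis
            using fps_quot_cancel[OF G_0, of 0] fps_quot_cancel[OF G_0, of 1]
            by (simp only: G_def mult_1_left)
        qed
        finally show ?thesis .
      qed
      ultimately show ?thesis by (simp only: mult.assoc[symmetric] mult_1_left)
    qed
    also have "fps_cong n \<dots> \<pi>"
      by (rule fps_cong_sym, rule fps_cong_mono[OF \<pi>(2)]) simp
    finally show "fps_cong n ((?T + \<sigma>) * ?D) \<pi>" .
  qed
  moreover have "fps_nth ?D 0 = 1" by (simp add: q_def)
  ultimately have "\<pi> \<oslash> ?D = ?T + \<sigma>"
    by (simp add: fps_quot_eq_iff)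
  then have "?T + \<sigma> = (1 \<oslash> ?D) * \<pi>"
    by (simp add: fps_quot_eq_mult[of \<pi>] mult.commute)
  moreover have "(\<Sum>n. F (n + 8)) = \<sigma>" by (rule sums_unique[OF sums, symmetric])
  moreover have "prodinf (\<lambda>n. G (n + 2)) = \<pi>" by (rule has_prod_unique[OF prod(1), symmetric])
  ultimately show "?T + (\<Sum>n. F (n + 8)) = (1 \<oslash> ?D) * prodinf (\<lambda>n. G (n + 2))"
    by (simp only:)
qed

text \<open>The parameters become constant series of the indeterminates. Convergence belongs to the
  claim, as it makes \<open>suminf\<close> and \<open>prodinf\<close> actual limits.\<close>

theorem theorem6:
  shows "let q = (fps_X :: coeff_ring fps);
             t = fps_const indet_t; w = fps_const indet_w;
             v = fps_const indet_v; x = fps_const indet_x;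
             F = (\<lambda>m::nat. q ^ (m * (m + 1)) \<oslash>
                   ((1 - q) * (1 - t * q^2) * (1 - w * q^3) * (1 - q^4) * (1 - q^5) * (1 - q^6)
                     * (1 - v * q^7) * (1 - x * q^8) * (\<Prod>i=9..m. 1 - q ^ i)));
             G = (\<lambda>k::nat. 1 \<oslash> ((1 - q ^ (5 * k + 2)) * (1 - q ^ (5 * k + 3))))
         in summable (\<lambda>n. F (n + 8)) \<and> convergent_prod (\<lambda>n. G (n + 2)) \<and>
            1 + q^2 * ((t + w * q) \<oslash> (1 - t * q^2))
              + q^6 * ((w^2 + v * q + x * q^2) \<oslash> ((1 - t * q^2) * (1 - w * q^3)))
              + q^12 * ((1 + q + v^2 * q^2 + x * v * q^3 + x^2 * q^4 + q^5 + q^6)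
                  \<oslash> ((1 - t * q^2) * (1 - w * q^3) * (1 - v * q^7)))
              + q^20 * ((x + x * q + q^2 + q^3 + (1 + x^3) * q^4 + (1 + x) * q^5 + (1 + x) * q^6
                    + q^7 + q^8 + q^9 + q^10)
                  \<oslash> ((1 - t * q^2) * (1 - w * q^3) * (1 - x * q^8) * (1 - v * q^7)))
              + q^30 * (((1 + q + q^2 + q^3 + q^4 + q^5 + q^6) * (1 + q^4))
                  \<oslash> ((1 - t * q^2) * (1 - w * q^3) * (1 - x * q^8) * (1 - q^5) * (1 - v * q^7)))
              + q^42 * (((1 + q + q^2 + q^3 + q^4 + q^5 + q^6) * (1 + q^4))
                  \<oslash> ((1 - t * q^2) * (1 - w * q^3) * (1 - x * q^8) * (1 - q^5) * (1 - q^6)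
                      * (1 - v * q^7)))
              + q^56 * ((1 + q^4)
                  \<oslash> ((1 - q) * (1 - t * q^2) * (1 - w * q^3) * (1 - x * q^8) * (1 - q^5)
                      * (1 - q^6) * (1 - v * q^7)))
              + (\<Sum>n. F (n + 8))
            = (1 \<oslash> ((1 - t * q^2) * (1 - w * q^3) * (1 - v * q^7) * (1 - x * q^8)))
                * prodinf (\<lambda>n. G (n + 2))"
  unfolding Let_def by (intro conjI rogers_ramanujan_parameters)

end
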